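(* For a nonnegative integer $s$ let $PF_8(s)$ denote the number of $8\times 8$ pandiagonal Franklin squares with magic sum $s$. Then $$PF_8(s)=\begin{cases}\frac{1}{2293760}s^8+\frac{1}{71680}s^7+\frac{1}{3840}s^6+\frac{1}{320}s^5+\frac{1}{40}s^4+\frac{2}{15}s^3+\frac{197}{420}s^2+\frac{106}{105}s+1 & \text{if } s\equiv 0\pmod 4,\\ 0 & \text{otherwise.}\end{cases}$$
   Context: An $8\times 8$ Franklin square with magic sum $s$ is an $8\times 8$ matrix $(y_{ij})_{1\le i,j\le 8}$ with nonnegative integer entries (not required to be distinct) such that: (1) every row and every column sums to $s$; (2) every half-row (the first four or the last four entries of a row) and every half-column (the first four or the last four entries of a column) sums to $s/2$; (3) every bent diagonal sums to $s$; (4) every $2\times 2$ subsquare of adjacent cells, including those that wrap around the edges (the square viewed as a torus), sums to $s/2$. The bent diagonals are the following 32 sets of 8 cells (row indices, resp. column indices, taken modulo 8; $k=0,\dots,7$): $\{(k+j,\,j):1\le j\le 4\}\cup\{(k+9-j,\,j): 5\le j\le 8\}$; $\{(k+9-j,\,j):1\le j\le 4\}\cup\{(k+j,\,j): 5\le j\le 8\}$; and the transposes of these sets (obtained by exchanging row and column coordinates). An $8\times 8$ pandiagonal Franklin square is an $8\times 8$ Franklin square in which every pandiagonal also sums to the magic sum $s$; the pandiagonals are the wrapped-around diagonals: with indices modulo 8, for each $k$, the cells $\{(i,i+k)\}$ and the cells $\{(i,k-i)\}$. *)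

theory Defs
  imports Complex_Main "HOL-Analysis.Finite_Cartesian_Product" "HOL-Library.Numeral_Type"
begin

text \<open>
  Matrices are indexed by the numeral type \<^typ>\<open>8\<close>, whose ring structure is arithmetic
  modulo 8. The indices 1, ..., 8 are thus the residues 1, ..., 7 and \<open>8 = 0\<close>, and index
  arithmetic wraps around the edges by itself.
\<close>

type_synonym cell = "8 \<times> 8"
type_synonym square = "nat ^ 8 ^ 8"

definition cell_sum :: "square \<Rightarrow> cell set \<Rightarrow> nat" where
  "cell_sum y C = (\<Sum>(i, j)\<in>C. y $ i $ j)"

text \<open>
  Cells are listed by integer coordinates and reduced modulo 8 by \<^const>\<open>of_int\<close>.
\<close>

definition red :: "int \<times> int \<Rightarrow> cell" where
  "red = map_prod of_int of_int"

definition full_row :: "int \<Rightarrow> cell set" where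
  "full_row i = red ` {(i, j) | j. 1 \<le> j \<and> j \<le> 8}"

definition left_half_row :: "int \<Rightarrow> cell set" where
  "left_half_row i = red ` {(i, j) | j. 1 \<le> j \<and> j \<le> 4}"

definition right_half_row :: "int \<Rightarrow> cell set" where
  "right_half_row i = red ` {(i, j) | j. 5 \<le> j \<and> j \<le> 8}"

definition bent_down :: "int \<Rightarrow> cell set" where
  "bent_down k =
     red ` ({(k + j, j) | j. 1 \<le> j \<and> j \<le> 4} \<union> {(k + 9 - j, j) | j. 5 \<le> j \<and> j \<le> 8})"

definition bent_up :: "int \<Rightarrow> cell set" where
  "bent_up k =
     red ` ({(k + 9 - j, j) | j. 1 \<le> j \<and> j \<le> 4} \<union> {(k + j, j) | j. 5 \<le> j \<and> j \<le> 8})"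

definition full_rows :: "cell set set" where
  "full_rows = {full_row i | i. 1 \<le> i \<and> i \<le> 8}"

definition half_rows :: "cell set set" where
  "half_rows = {left_half_row i | i. 1 \<le> i \<and> i \<le> 8} \<union> {right_half_row i | i. 1 \<le> i \<and> i \<le> 8}"

definition transposes :: "cell set set \<Rightarrow> cell set set" where
  "transposes F = (\<lambda>C. prod.swap ` C) ` F"

definition bent_diagonals :: "cell set set" where
  "bent_diagonals =
     (let B = {bent_down k | k. 0 \<le> k \<and> k \<le> 7} \<union> {bent_up k | k. 0 \<le> k \<and> k \<le> 7}
      in B \<union> transposes B)"

definition subsquares :: "cell set set" where
  "subsquares = {{(i, j), (i, j + 1), (i + 1, j), (i + 1, j + 1)} | i j. True}"

definition pandiagonals :: "cell set set" where
  "pandiagonals = {{(i, i + k) | i. True} | k. True} \<union> {{(i, k - i) | i. True} | k. True}"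

text \<open>
  The conditions ``sums to \<open>s/2\<close>'' are written with a factor 2 on the left, so that they are
  unsatisfiable for odd \<open>s\<close>; truncating division on \<^typ>\<open>nat\<close> would be wrong here.
\<close>

definition franklin_square :: "nat \<Rightarrow> square \<Rightarrow> bool" where
  "franklin_square s y \<longleftrightarrow>
     (\<forall>C \<in> full_rows \<union> transposes full_rows. cell_sum y C = s) \<and>
     (\<forall>C \<in> half_rows \<union> transposes half_rows. 2 * cell_sum y C = s) \<and>
     (\<forall>C \<in> bent_diagonals. cell_sum y C = s) \<and>
     (\<forall>C \<in> subsquares. 2 * cell_sum y C = s)"

definition pandiagonal_franklin_square :: "nat \<Rightarrow> square \<Rightarrow> bool" where
  "pandiagonal_franklin_square s y \<longleftrightarrow>
     franklin_square s y \<and> (\<forall>C \<in> pandiagonals. cell_sum y C = s)"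

definition PF8 :: "nat \<Rightarrow> nat" where
  "PF8 s = card {y. pandiagonal_franklin_square s y}"

end

theory Submission
  imports Defs
begin

text \<open>
  With \<open>t = s / 2\<close>, the subsquare condition says that \<open>(-1)\<^sup>i\<^sup>+\<^sup>j (4 y\<^sub>i\<^sub>j - t)\<close> has the form \<open>a\<^sub>i + b\<^sub>j\<close>.
  The half-row, half-column, bent diagonal and pandiagonal conditions then force
  \<open>s = 4 m\<close> and \<open>2 y\<^sub>i\<^sub>j = m + (-1)\<^sup>j P\<^sub>i + (-1)\<^sup>i Q\<^sub>j\<close>, where \<open>P\<close> and \<open>Q\<close> are integer vectors with
  \<open>P\<^sub>i\<^sub>+\<^sub>2 = - P\<^sub>i\<close> and \<open>Q\<^sub>i\<^sub>+\<^sub>2 = - Q\<^sub>i\<close> for \<open>i = 1, 2, 5, 6\<close>, so that each has four free coordinates;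
  conversely all such entries satisfy the conditions. All signs of \<open>P\<^sub>i\<close> and \<open>Q\<^sub>j\<close> occur in the
  entries, so nonnegativity and integrality mean \<open>max |P\<^sub>i| + max |Q\<^sub>j| \<le> m\<close> and \<open>P\<^sub>i + Q\<^sub>j \<equiv> m\<close>
  modulo 2. Counting by \<open>n = max |P\<^sub>i|\<close>, for which there are \<open>(n + 1)\<^sup>4 - (n - 1)\<^sup>4 = 8 n\<^sup>3 + 8 n\<close>
  choices of \<open>P\<close> (one if \<open>n = 0\<close>) and \<open>(m - n + 1)\<^sup>4\<close> choices of \<open>Q\<close>, gives the polynomial.
\<close>

section \<open>Arithmetic of indices modulo 8\<close>

lemma exhaust_8: "(i::8) \<in> {0, 1, 2, 3, 4, 5, 6, 7}"
proof (induct i)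
  case (of_int z)
  then have "z \<in> {0, 1, 2, 3, 4, 5, 6, 7}" by auto
  then show ?case by auto
qed

lemma UNIV_8: "(UNIV :: 8 set) = {0, 1, 2, 3, 4, 5, 6, 7}"
  using exhaust_8 by blast

lemma all_8: "(\<forall>i::8. P i) \<longleftrightarrow> P 0 \<and> P 1 \<and> P 2 \<and> P 3 \<and> P 4 \<and> P 5 \<and> P 6 \<and> P 7"
  unfolding ball_UNIV [symmetric] UNIV_8 by (simp only: ball_simps simp_thms)

lemma sum_8: "(\<Sum>i\<in>(UNIV::8 set). f i) = f 0 + f 1 + f 2 + f 3 + f 4 + f 5 + f 6 + f 7"
  unfolding UNIV_8 by (simp add: add.assoc)

lemma numeral_mod_8:
  "(8::8) = 0" "(9::8) = 1" "(10::8) = 2" "(11::8) = 3" "(12::8) = 4" "(13::8) = 5" "(14::8) = 6"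
  "(15::8) = 7"
  "(-1::8) = 7" "(-2::8) = 6" "(-3::8) = 5" "(-4::8) = 4" "(-5::8) = 3" "(-6::8) = 2" "(-7::8) = 1"
  by simp_all

lemma int_intervals:
  "{1..4::int} = {1, 2, 3, 4}" "{5..8::int} = {5, 6, 7, 8}" "{1..8::int} = {1, 2, 3, 4, 5, 6, 7, 8}"
  "{0..7::int} = {0, 1, 2, 3, 4, 5, 6, 7}"
  by auto

lemma range_of_int_8: "of_int ` {1..8} = (UNIV :: 8 set)" "of_int ` {0..7} = (UNIV :: 8 set)"
  unfolding UNIV_8 int_intervals by (simp_all add: numeral_mod_8 insert_commute)

lemma inj_on_of_int_8: "inj_on (of_int :: int \<Rightarrow> 8) {1..8}"
  by (simp add: int_intervals)

section \<open>Cell sums as explicit sums of entries\<close>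

text \<open>Columns between 1 and 8 keep distinct residues, so no two cells merge under
  \<open>red\<close>.\<close>

lemma cell_sum_red_graph:
  assumes "1 \<le> a" and "b \<le> 8"
  shows "cell_sum y (red ` {(f j, j) | j. a \<le> j \<and> j \<le> b}) = (\<Sum>j\<in>{a..b}. y $ of_int (f j) $ of_int j)"
proof -
  have "red ` {(f j, j) | j. a \<le> j \<and> j \<le> b} = (\<lambda>j. (of_int (f j), of_int j)) ` {a..b}"
    by (auto simp: red_def)
  moreover have "inj_on (of_int :: int \<Rightarrow> 8) {a..b}"
    using assms by (intro inj_on_subset [OF inj_on_of_int_8]) auto
  then have "inj_on (\<lambda>j. (of_int (f j) :: 8, of_int j :: 8)) {a..b}"
    by (auto simp: inj_on_def)
  ultimately show ?thesis
    by (simp add: cell_sum_def sum.reindex)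
qed

lemma cell_sum_half_row:
  "cell_sum y (left_half_row i) = y $ of_int i $ 1 + y $ of_int i $ 2 + y $ of_int i $ 3 + y $ of_int i $ 4"
  "cell_sum y (right_half_row i) = y $ of_int i $ 5 + y $ of_int i $ 6 + y $ of_int i $ 7 + y $ of_int i $ 0"
  by (simp_all add: left_half_row_def right_half_row_def cell_sum_red_graph [where f = "\<lambda>_. i"]
      int_intervals(1,2) numeral_mod_8)

lemma cell_sum_full_row:
  "cell_sum y (full_row i) = cell_sum y (left_half_row i) + cell_sum y (right_half_row i)"
  by (simp add: full_row_def cell_sum_red_graph [where f = "\<lambda>_. i"] cell_sum_half_row
      int_intervals(3) numeral_mod_8)

lemma cell_sum_bent_down:
  fixes k :: int
  defines "r \<equiv> of_int k :: 8"
  shows "cell_sum y (bent_down k) = y $ (r + 1) $ 1 + y $ (r + 2) $ 2 + y $ (r + 3) $ 3 + y $ (r + 4) $ 4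
    + y $ (r + 4) $ 5 + y $ (r + 3) $ 6 + y $ (r + 2) $ 7 + y $ (r + 1) $ 0"
proof -
  \<comment> \<open>Both arms together form one graph over the columns 1 to 8, the form that
    \<open>cell_sum_red_graph\<close> evaluates.\<close>
  define f where "f j = (if j \<le> 4 then k + j else k + 9 - j)" for j
  have "{(k + j, j) | j. 1 \<le> j \<and> j \<le> 4} \<union> {(k + 9 - j, j) | j. 5 \<le> j \<and> j \<le> 8}
      = {(f j, j) | j. 1 \<le> j \<and> j \<le> 8}" (is "?A = ?B")
  proof
    have "f j = k + j" if "j \<le> 4" for j using that by (simp add: f_def)
    moreover have "f j = k + 9 - j" if "5 \<le> j" for j using that by (simp add: f_def)
    ultimately show "?A \<subseteq> ?B" by auto
    show "?B \<subseteq> ?A" by (auto simp: f_def split: if_splits)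
  qed
  then have "cell_sum y (bent_down k) = (\<Sum>j\<in>{1..8}. y $ of_int (f j) $ of_int j)"
    by (simp add: bent_down_def cell_sum_red_graph)
  then show ?thesis
    by (simp add: int_intervals(3) f_def r_def numeral_mod_8 ac_simps)
qed

lemma cell_sum_bent_up:
  fixes k :: int
  defines "r \<equiv> of_int k :: 8"
  shows "cell_sum y (bent_up k) = y $ r $ 1 + y $ (r + 7) $ 2 + y $ (r + 6) $ 3 + y $ (r + 5) $ 4
    + y $ (r + 5) $ 5 + y $ (r + 6) $ 6 + y $ (r + 7) $ 7 + y $ r $ 0"
proof -
  define f where "f j = (if j \<le> 4 then k + 9 - j else k + j)" for j
  have "{(k + 9 - j, j) | j. 1 \<le> j \<and> j \<le> 4} \<union> {(k + j, j) | j. 5 \<le> j \<and> j \<le> 8}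
      = {(f j, j) | j. 1 \<le> j \<and> j \<le> 8}" (is "?A = ?B")
  proof
    have "f j = k + 9 - j" if "j \<le> 4" for j using that by (simp add: f_def)
    moreover have "f j = k + j" if "5 \<le> j" for j using that by (simp add: f_def)
    ultimately show "?A \<subseteq> ?B" by auto
    show "?B \<subseteq> ?A" by (auto simp: f_def split: if_splits)
  qed
  then have "cell_sum y (bent_up k) = (\<Sum>j\<in>{1..8}. y $ of_int (f j) $ of_int j)"
    by (simp add: bent_up_def cell_sum_red_graph)
  then show ?thesis
    by (simp add: int_intervals(3) f_def r_def numeral_mod_8 ac_simps)
qed

text \<open>Row-oriented conditions only; swapping the arguments of \<open>z\<close> gives the
  column-oriented ones. A full line enters through its two halves.\<close>

definition line_sums :: "nat \<Rightarrow> (8 \<Rightarrow> 8 \<Rightarrow> nat) \<Rightarrow> bool" where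
  "line_sums s z \<longleftrightarrow>
     (\<forall>r. 2 * (z r 1 + z r 2 + z r 3 + z r 4) = s) \<and>
     (\<forall>r. 2 * (z r 5 + z r 6 + z r 7 + z r 0) = s) \<and>
     (\<forall>r. z (r + 1) 1 + z (r + 2) 2 + z (r + 3) 3 + z (r + 4) 4
        + z (r + 4) 5 + z (r + 3) 6 + z (r + 2) 7 + z (r + 1) 0 = s) \<and>
     (\<forall>r. z r 1 + z (r + 7) 2 + z (r + 6) 3 + z (r + 5) 4
        + z (r + 5) 5 + z (r + 6) 6 + z (r + 7) 7 + z r 0 = s)"

lemma all_of_int_8:
  "(\<forall>k. 1 \<le> k \<and> k \<le> 8 \<longrightarrow> P (of_int k :: 8)) \<longleftrightarrow> (\<forall>r. P r)"
  "(\<forall>k. 0 \<le> k \<and> k \<le> 7 \<longrightarrow> P (of_int k :: 8)) \<longleftrightarrow> (\<forall>r. P r)"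
proof -
  have "(\<forall>k. a \<le> k \<and> k \<le> b \<longrightarrow> P (of_int k)) \<longleftrightarrow> (\<forall>r \<in> of_int ` {a..b}. P r)" for a b
    by auto
  from this [of 1 8] this [of 0 7]
  show "(\<forall>k. 1 \<le> k \<and> k \<le> 8 \<longrightarrow> P (of_int k :: 8)) \<longleftrightarrow> (\<forall>r. P r)"
    "(\<forall>k. 0 \<le> k \<and> k \<le> 7 \<longrightarrow> P (of_int k :: 8)) \<longleftrightarrow> (\<forall>r. P r)"
    by (simp_all only: range_of_int_8 ball_UNIV)
qed

lemma line_sums_iff:
  "(\<forall>C \<in> full_rows. cell_sum y C = s) \<and> (\<forall>C \<in> half_rows. 2 * cell_sum y C = s) \<and>
   (\<forall>C \<in> {bent_down k | k. 0 \<le> k \<and> k \<le> 7} \<union> {bent_up k | k. 0 \<le> k \<and> k \<le> 7}. cell_sum y C = s)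
   \<longleftrightarrow> line_sums s (\<lambda>i j. y $ i $ j)"
proof -
  have full: "(\<forall>C \<in> full_rows. cell_sum y C = s)" if "\<forall>C \<in> half_rows. 2 * cell_sum y C = s"
  proof
    fix C assume "C \<in> full_rows"
    then obtain i where i: "C = full_row i" "1 \<le> i" "i \<le> 8" by (auto simp: full_rows_def)
    then have "2 * cell_sum y (left_half_row i) = s" "2 * cell_sum y (right_half_row i) = s"
      using that by (auto simp: half_rows_def)
    then show "cell_sum y C = s" by (simp add: i cell_sum_full_row)
  qed
  have ball_Coll: "(\<forall>C \<in> {g k | k. R k} \<union> {h k | k. R k}. Q C) \<longleftrightarrow> (\<forall>k. R k \<longrightarrow> Q (g k)) \<and> (\<forall>k. R k \<longrightarrow> Q (h k))"
    for g h :: "int \<Rightarrow> cell set" and R Q by blast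
  have half: "(\<forall>C \<in> half_rows. 2 * cell_sum y C = s) \<longleftrightarrow>
     (\<forall>r. 2 * (y $ r $ 1 + y $ r $ 2 + y $ r $ 3 + y $ r $ 4) = s) \<and>
     (\<forall>r. 2 * (y $ r $ 5 + y $ r $ 6 + y $ r $ 7 + y $ r $ 0) = s)"
    unfolding half_rows_def ball_Coll cell_sum_half_row
    by (intro arg_cong2 [of _ _ _ _ "(\<and>)"] all_of_int_8)
  have bent: "(\<forall>C \<in> {bent_down k | k. 0 \<le> k \<and> k \<le> 7} \<union> {bent_up k | k. 0 \<le> k \<and> k \<le> 7}. cell_sum y C = s)
    \<longleftrightarrow> (\<forall>r. y $ (r + 1) $ 1 + y $ (r + 2) $ 2 + y $ (r + 3) $ 3 + y $ (r + 4) $ 4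
        + y $ (r + 4) $ 5 + y $ (r + 3) $ 6 + y $ (r + 2) $ 7 + y $ (r + 1) $ 0 = s) \<and>
     (\<forall>r. y $ r $ 1 + y $ (r + 7) $ 2 + y $ (r + 6) $ 3 + y $ (r + 5) $ 4
        + y $ (r + 5) $ 5 + y $ (r + 6) $ 6 + y $ (r + 7) $ 7 + y $ r $ 0 = s)"
    unfolding ball_Coll cell_sum_bent_down cell_sum_bent_up
    by (intro arg_cong2 [of _ _ _ _ "(\<and>)"] all_of_int_8)
  show ?thesis
    unfolding line_sums_def bent using full half by blast
qed

text \<open>Turns a transposed family of cells into the original family on the transposed square, so
  that \<open>line_sums\<close> serves both orientations.\<close>

lemma cell_sum_swap: "cell_sum y (prod.swap ` C) = cell_sum (\<chi> i j. y $ j $ i) C"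
  unfolding cell_sum_def by (subst sum.reindex) (simp_all add: case_prod_beta)

lemma cell_sum_subsquare:
  "cell_sum y {(i, j), (i, j + 1), (i + 1, j), (i + 1, j + 1)} =
     y $ i $ j + y $ i $ (j + 1) + y $ (i + 1) $ j + y $ (i + 1) $ (j + 1)"
  by (simp add: cell_sum_def)

lemma cell_sum_graph: "cell_sum y {(i, f i) | i. True} = (\<Sum>i\<in>UNIV. y $ i $ f i)"
proof -
  have "{(i, f i) | i. True} = (\<lambda>i. (i, f i)) ` UNIV" by auto
  then show ?thesis by (simp add: cell_sum_def sum.reindex inj_on_def)
qed

lemma pandiagonal_franklin_square_iff:
  "pandiagonal_franklin_square s y \<longleftrightarrow>
     line_sums s (\<lambda>i j. y $ i $ j) \<and> line_sums s (\<lambda>i j. y $ j $ i) \<and>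
     (\<forall>i j. 2 * (y $ i $ j + y $ i $ (j + 1) + y $ (i + 1) $ j + y $ (i + 1) $ (j + 1)) = s) \<and>
     (\<forall>k. (\<Sum>i\<in>UNIV. y $ i $ (i + k)) = s) \<and> (\<forall>k. (\<Sum>i\<in>UNIV. y $ i $ (k - i)) = s)"
proof -
  let ?B = "{bent_down k | k. 0 \<le> k \<and> k \<le> 7} \<union> {bent_up k | k. 0 \<le> k \<and> k \<le> 7}"
  let ?y' = "\<chi> i j. y $ j $ i"
  have bent: "bent_diagonals = ?B \<union> transposes ?B"
    by (simp add: bent_diagonals_def Let_def)
  have tr: "(\<forall>C \<in> F \<union> transposes F. Q (cell_sum y C)) \<longleftrightarrow>
    (\<forall>C \<in> F. Q (cell_sum y C)) \<and> (\<forall>C \<in> F. Q (cell_sum ?y' C))" for F Q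
    unfolding cell_sum_swap [symmetric] transposes_def by blast
  have sub: "(\<forall>C \<in> subsquares. 2 * cell_sum y C = s) \<longleftrightarrow>
    (\<forall>i j. 2 * (y $ i $ j + y $ i $ (j + 1) + y $ (i + 1) $ j + y $ (i + 1) $ (j + 1)) = s)"
    unfolding cell_sum_subsquare [symmetric] subsquares_def by blast
  have pan: "(\<forall>C \<in> pandiagonals. cell_sum y C = s) \<longleftrightarrow>
    (\<forall>k. (\<Sum>i\<in>UNIV. y $ i $ (i + k)) = s) \<and> (\<forall>k. (\<Sum>i\<in>UNIV. y $ i $ (k - i)) = s)"
    unfolding cell_sum_graph [symmetric] pandiagonals_def by blast
  have l: "line_sums s (\<lambda>i j. y $ j $ i) = line_sums s (\<lambda>i j. ?y' $ i $ j)" by simp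
  show ?thesis
    unfolding pandiagonal_franklin_square_def franklin_square_def bent
      tr [of _ "\<lambda>x. x = s"] tr [of _ "\<lambda>x. 2 * x = s"] sub pan l line_sums_iff [symmetric]
    by (rule iffI; elim conjE; intro conjI; assumption)
qed

section \<open>Parametrization of the solutions of the linear conditions\<close>

lemma shift_invariant_8:
  assumes "\<And>i::8. f (i + 1) = f i"
  shows "f i = f 0"
proof -
  have "\<forall>i. f i = f 0"
    using assms [of 0] assms [of 1] assms [of 2] assms [of 3] assms [of 4] assms [of 5] assms [of 6]
    unfolding all_8 by simp
  then show ?thesis by blast
qed

text \<open>The sign \<open>(-1)^i\<close>, well defined on residues because 8 is even.\<close>

definition sg :: "8 \<Rightarrow> int" where
  "sg i = (if i \<in> {0, 2, 4, 6} then 1 else - 1)"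

lemma sg_simps [simp]:
  "sg 0 = 1" "sg 1 = - 1" "sg 2 = 1" "sg 3 = - 1" "sg 4 = 1" "sg 5 = - 1" "sg 6 = 1" "sg 7 = - 1"
  by (simp_all add: sg_def)

lemma sg_cases: "sg i = 1 \<or> sg i = - 1"
  by (simp add: sg_def)

lemma sg_Suc: "sg (i + 1) = - sg i"
proof -
  have "\<forall>i. sg (i + 1) = - sg i"
    unfolding all_8 by (simp add: numeral_mod_8)
  then show ?thesis by blast
qed

text \<open>One index from each of the pairs {1,3}, {2,4}, {5,7}, {6,0}; \<open>ext\<close> is
  antisymmetric within each pair.\<close>

definition base :: "8 set" where
  "base = {1, 2, 5, 6}"

definition ext :: "(8 \<Rightarrow> int) \<Rightarrow> 8 \<Rightarrow> int" where
  "ext p i = (if i \<in> base then p i else - p (i - 2))"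

lemma ext_simps [simp]:
  "ext p 0 = - p 6" "ext p 1 = p 1" "ext p 2 = p 2" "ext p 3 = - p 1"
  "ext p 4 = - p 2" "ext p 5 = p 5" "ext p 6 = p 6" "ext p 7 = - p 5"
  by (simp_all add: ext_def base_def numeral_mod_8)

text \<open>The signs are crossed because in \<open>sg i * sg j * (a i + b j)\<close> the factor
  \<open>sg i\<close> is absorbed into \<open>ext p i\<close> and the factor \<open>sg j\<close>
  into \<open>ext q j\<close>.\<close>

definition encodes :: "nat \<Rightarrow> (8 \<Rightarrow> int) \<Rightarrow> (8 \<Rightarrow> int) \<Rightarrow> square \<Rightarrow> bool" where
  "encodes m p q y \<longleftrightarrow> (\<forall>i j. 2 * int (y $ i $ j) = int m + sg j * ext p i + sg i * ext q j)"

text \<open>Multiplication by the checkerboard sign turns the vanishing sums over subsquares into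
  vanishing mixed differences, and a function with these is a row part plus a column part.\<close>

lemma alternating_decomposition:
  fixes x :: "8 \<Rightarrow> 8 \<Rightarrow> int"
  assumes "\<And>i j. x i j + x i (j + 1) + x (i + 1) j + x (i + 1) (j + 1) = 0"
  obtains a b where "\<And>i j. x i j = sg i * sg j * (a i + b j)"
proof -
  define w where "w i j = sg i * sg j * x i j" for i j
  have "w (i + 1) (j + 1) - w (i + 1) j = w i (j + 1) - w i j" for i j
    using assms [of i j] sg_cases [of i] sg_cases [of j] by (auto simp: w_def sg_Suc)
  then have step: "w i (j + 1) - w i j = w 0 (j + 1) - w 0 j" for i j
    by (rule shift_invariant_8)
  have "w i (j + 1) - w 0 (j + 1) = w i j - w 0 j" for i j
    using step [of i j] by linarith
  then have w: "w i j - w 0 j = w i 0 - w 0 0" for i j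
    by (rule shift_invariant_8)
  have "x i j = sg i * sg j * (w i 0 + (w 0 j - w 0 0))" for i j
  proof -
    have "x i j = sg i * sg j * w i j"
      using sg_cases [of i] sg_cases [of j] by (auto simp: w_def)
    moreover have "w i j = w i 0 + (w 0 j - w 0 0)" using w [of i j] by simp
    ultimately show ?thesis by simp
  qed
  then show ?thesis by (rule that)
qed

text \<open>For \<open>i\<close> in \<open>base\<close>, the step to \<open>i + 2\<close> keeps
  \<open>sg\<close> and negates \<open>ext p\<close>. So \<open>p\<close> is half the change of
  sign, read off from column 1, where \<open>sg 1 = - 1\<close> gives the order of the difference;
  likewise \<open>q\<close> from row 1.\<close>

lemma encodes_if_pandiagonal_franklin:
  assumes "pandiagonal_franklin_square s y"
  defines "p \<equiv> \<lambda>i. int (y $ (i + 2) $ 1) - int (y $ i $ 1)"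
    and "q \<equiv> \<lambda>j. int (y $ 1 $ (j + 2)) - int (y $ 1 $ j)"
  shows "\<exists>m. s = 4 * m \<and> encodes m p q y"
proof -
  have rows: "line_sums s (\<lambda>i j. y $ i $ j)" and cols: "line_sums s (\<lambda>i j. y $ j $ i)"
    and sub: "\<And>i j. 2 * (y $ i $ j + y $ i $ (j + 1) + y $ (i + 1) $ j + y $ (i + 1) $ (j + 1)) = s"
    and pan: "(\<Sum>i\<in>UNIV. y $ i $ (i + 0)) = s"
    using assms(1) unfolding pandiagonal_franklin_square_iff by blast+
  define t where "t = y $ 0 $ 0 + y $ 0 $ (0 + 1) + y $ (0 + 1) $ 0 + y $ (0 + 1) $ (0 + 1)"
  have s: "s = 2 * t" using sub [of 0 0] by (simp add: t_def)
  define x where "x i j = 4 * int (y $ i $ j) - int t" for i j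
  have "x i j + x i (j + 1) + x (i + 1) j + x (i + 1) (j + 1) = 0" for i j
    using sub [of i j] s by (simp add: x_def)
  then obtain a b where ab: "\<And>i j. x i j = sg i * sg j * (a i + b j)"
    by (rule alternating_decomposition) blast
  have y: "4 * int (y $ i $ j) = int t + sg i * sg j * (a i + b j)" for i j
    using ab [of i j] by (simp add: x_def)
  have half_rows: "y $ 0 $ 1 + y $ 0 $ 2 + y $ 0 $ 3 + y $ 0 $ 4 = t"
    "y $ 0 $ 5 + y $ 0 $ 6 + y $ 0 $ 7 + y $ 0 $ 0 = t"
    and row_bent: "y $ (0 + 1) $ 1 + y $ (0 + 2) $ 2 + y $ (0 + 3) $ 3 + y $ (0 + 4) $ 4
        + y $ (0 + 4) $ 5 + y $ (0 + 3) $ 6 + y $ (0 + 2) $ 7 + y $ (0 + 1) $ 0 = s"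
    using rows s unfolding line_sums_def by (auto dest: spec [of _ 0])
  have half_cols: "y $ 1 $ 0 + y $ 2 $ 0 + y $ 3 $ 0 + y $ 4 $ 0 = t"
    "y $ 5 $ 0 + y $ 6 $ 0 + y $ 7 $ 0 + y $ 0 $ 0 = t"
    and col_bent: "y $ 1 $ (0 + 1) + y $ 2 $ (0 + 2) + y $ 3 $ (0 + 3) + y $ 4 $ (0 + 4)
        + y $ 5 $ (0 + 4) + y $ 6 $ (0 + 3) + y $ 7 $ (0 + 2) + y $ 0 $ (0 + 1) = s"
    using cols s unfolding line_sums_def by (auto dest: spec [of _ 0])
  \<comment> \<open>Signs alternate along column 0, so \<open>b 0\<close> cancels from each
    half-column.\<close>
  have a: "a 1 + a 3 = a 2 + a 4" "a 5 + a 7 = a 6 + a 0"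
    using half_cols y [of 1 0] y [of 2 0] y [of 3 0] y [of 4 0] y [of 5 0] y [of 6 0] y [of 7 0] y [of 0 0]
    by simp_all
  have b: "b 1 + b 3 = b 2 + b 4" "b 5 + b 7 = b 6 + b 0"
    using half_rows y [of 0 1] y [of 0 2] y [of 0 3] y [of 0 4] y [of 0 5] y [of 0 6] y [of 0 7] y [of 0 0]
    by simp_all
  \<comment> \<open>The two arms use the same rows with opposite signs, so the \<open>a\<close>
    terms cancel.\<close>
  have b': "b 1 + b 2 + b 3 + b 4 = b 5 + b 6 + b 7 + b 0"
    using row_bent s y [of 1 1] y [of 2 2] y [of 3 3] y [of 4 4] y [of 4 5] y [of 3 6] y [of 2 7] y [of 1 0]
    by simp
  have a': "a 1 + a 2 + a 3 + a 4 = a 5 + a 6 + a 7 + a 0"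
    using col_bent s y [of 1 1] y [of 2 2] y [of 3 3] y [of 4 4] y [of 5 4] y [of 6 3] y [of 7 2] y [of 0 1]
    by simp
  \<comment> \<open>Every sign on the main diagonal is positive, which ties the total of
    \<open>a\<close> to the total of \<open>b\<close>.\<close>
  have "y $ 0 $ 0 + y $ 1 $ 1 + y $ 2 $ 2 + y $ 3 $ 3 + y $ 4 $ 4 + y $ 5 $ 5 + y $ 6 $ 6 + y $ 7 $ 7 = s"
    using pan unfolding sum_8 by simp
  then have ab0: "a 0 + a 1 + a 2 + a 3 + a 4 + a 5 + a 6 + a 7 +
      (b 0 + b 1 + b 2 + b 3 + b 4 + b 5 + b 6 + b 7) = 0"
    using s y [of 0 0] y [of 1 1] y [of 2 2] y [of 3 3] y [of 4 4] y [of 5 5] y [of 6 6] y [of 7 7]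
    by simp
  \<comment> \<open>All four pair sums of \<open>a\<close> equal \<open>c\<close>; the diagonal then
    makes those of \<open>b\<close> equal \<open>- c\<close>.\<close>
  define c where "c = a 1 + a 3"
  have a_eq: "a 3 = c - a 1" "a 4 = c - a 2" "a 7 = c - a 5" "a 0 = c - a 6"
    using a a' by (simp_all add: c_def)
  have b_eq: "b 3 = - c - b 1" "b 4 = - c - b 2" "b 7 = - c - b 5" "b 0 = - c - b 6"
    using b b' ab0 a_eq by simp_all
  \<comment> \<open>The deviations from \<open>t\<close> at these two cells cancel, so
    \<open>t\<close> is twice a sum of entries. This is what makes \<open>s\<close> divisible by
    4.\<close>
  define m where "m = y $ 1 $ 1 + y $ 3 $ 3"
  have t: "t = 2 * m"
    using y [of 1 1] y [of 3 3] a_eq b_eq by (simp add: m_def)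
  \<comment> \<open>Moving \<open>c / 2\<close> from \<open>a\<close> to \<open>b\<close> makes both
    antisymmetric within each pair; the factors 4 and 2 avoid fractions.\<close>
  have p: "\<forall>i. 4 * ext p i = sg i * (2 * a i - c)"
    unfolding all_8
    using y [of 1 1] y [of 2 1] y [of 3 1] y [of 4 1] y [of 5 1] y [of 6 1] y [of 7 1] y [of 0 1] a_eq
    by (simp add: p_def numeral_mod_8)
  have q: "\<forall>j. 4 * ext q j = sg j * (2 * b j + c)"
    unfolding all_8
    using y [of 1 1] y [of 1 2] y [of 1 3] y [of 1 4] y [of 1 5] y [of 1 6] y [of 1 7] y [of 1 0] b_eq
    by (simp add: q_def numeral_mod_8)
  have "2 * int (y $ i $ j) = int m + sg j * ext p i + sg i * ext q j" for i j
    using y [of i j] t sg_cases [of i] sg_cases [of j] p [rule_format, of i] q [rule_format, of j]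
    by auto
  then show ?thesis unfolding encodes_def using s t by auto
qed

text \<open>Alternating signs or the antisymmetry of \<open>ext\<close> cancel the \<open>p\<close>
  and \<open>q\<close> terms in every prescribed sum.\<close>

lemma pandiagonal_franklin_if_encodes:
  assumes "encodes m p q y"
  shows "pandiagonal_franklin_square (4 * m) y"
proof -
  \<comment> \<open>Over the reals each entry has a closed expression, so the conditions become
    linear identities.\<close>
  have y: "real (y $ i $ j) = (real m + real_of_int (sg j * ext p i + sg i * ext q j)) / 2" for i j
  proof -
    have "2 * int (y $ i $ j) = int m + (sg j * ext p i + sg i * ext q j)"
      using assms by (simp add: encodes_def)
    then have "real_of_int (2 * int (y $ i $ j)) = real_of_int (int m + (sg j * ext p i + sg i * ext q j))"
      by (rule arg_cong)
    then show ?thesis by simp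
  qed
  have eq: "u = v \<longleftrightarrow> real u = real v" for u v by simp
  have "line_sums (4 * m) (\<lambda>i j. y $ i $ j)"
    unfolding line_sums_def all_8 eq by (simp add: y numeral_mod_8 field_simps)
  moreover have "line_sums (4 * m) (\<lambda>i j. y $ j $ i)"
    unfolding line_sums_def all_8 eq by (simp add: y numeral_mod_8 field_simps)
  moreover have "\<forall>i j. 2 * (y $ i $ j + y $ i $ (j + 1) + y $ (i + 1) $ j + y $ (i + 1) $ (j + 1)) = 4 * m"
    unfolding eq by (simp add: y sg_Suc field_simps)
  moreover have "\<forall>k. (\<Sum>i\<in>UNIV. y $ i $ (i + k)) = 4 * m"
    unfolding all_8 sum_8 eq by (simp add: y numeral_mod_8 field_simps)
  moreover have "\<forall>k. (\<Sum>i\<in>UNIV. y $ i $ (k - i)) = 4 * m"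
    unfolding all_8 sum_8 eq by (simp add: y numeral_mod_8 field_simps)
  ultimately show ?thesis
    unfolding pandiagonal_franklin_square_iff by blast
qed

section \<open>Squares and admissible parameter vectors\<close>

lemma finite_base [simp]: "finite base" and card_base: "card base = 4"
  by (simp_all add: base_def)

lemma ext_cases: "\<exists>i'\<in>base. ext p i = p i' \<or> ext p i = - p i'"
proof -
  have "\<forall>i. \<exists>i'\<in>base. ext p i = p i' \<or> ext p i = - p i'"
    unfolding all_8 by (auto simp: base_def)
  then show ?thesis by blast
qed

lemma base_translate: "i \<in> base \<Longrightarrow> i + 2 \<notin> base \<and> sg (i + 2) = sg i"
  by (auto simp: base_def numeral_mod_8)

lemma ext_base: "i \<in> base \<Longrightarrow> ext p i = p i" "i \<in> base \<Longrightarrow> ext p (i + 2) = - p i"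
  using base_translate by (auto simp: ext_def)

lemma ext_restrict [simp]: "ext (restrict p base) = ext p"
proof -
  have "\<forall>i. ext (restrict p base) i = ext p i"
    unfolding all_8 by (simp add: base_def)
  then show ?thesis by blast
qed

text \<open>\<open>PiE\<close> fixes the values off \<open>base\<close>, which no square determines,
  so that vectors can be counted.\<close>

definition box :: "int \<Rightarrow> (8 \<Rightarrow> int) set" where
  "box n = PiE base (\<lambda>_. {x. \<bar>x\<bar> \<le> n \<and> even (n - x)})"

text \<open>The products may overlap: \<open>n\<close> is any bound on \<open>p\<close> of the right
  parity that leaves \<open>m - n\<close> as a bound on \<open>q\<close>.\<close>

definition params :: "nat \<Rightarrow> ((8 \<Rightarrow> int) \<times> (8 \<Rightarrow> int)) set" where
  "params m = (\<Union>n\<le>m. box (int n) \<times> box (int m - int n))"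

text \<open>The bound \<open>n = max |p i|\<close> separates the joint inequality into one for
  \<open>p\<close> and one for \<open>q\<close>; the joint parity forces a common parity on all
  \<open>p i\<close> and the matching one on all \<open>q j\<close>.\<close>

lemma params_iff:
  "(p, q) \<in> params m \<longleftrightarrow> p \<in> extensional base \<and> q \<in> extensional base \<and>
     (\<forall>i\<in>base. \<forall>j\<in>base. \<bar>p i\<bar> + \<bar>q j\<bar> \<le> int m \<and> even (int m + p i + q j))"
    (is "?L \<longleftrightarrow> ?R")
proof
  assume ?L
  then obtain n where n: "n \<le> m" "p \<in> box (int n)" "q \<in> box (int m - int n)"
    by (auto simp: params_def)
  have "\<bar>p i\<bar> + \<bar>q j\<bar> \<le> int m \<and> even (int m + p i + q j)" if "i \<in> base" "j \<in> base" for i j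
  proof -
    have "\<bar>p i\<bar> \<le> int n" "even (int n - p i)" "\<bar>q j\<bar> \<le> int m - int n" "even (int m - int n - q j)"
      using n that by (auto simp: box_def)
    then show ?thesis by presburger
  qed
  then show ?R using n by (auto simp: box_def PiE_def)
next
  assume R: ?R
  have "(\<lambda>i. \<bar>p i\<bar>) ` base \<noteq> {}" by (simp add: base_def)
  then obtain i0 where i0: "i0 \<in> base" "Max ((\<lambda>i. \<bar>p i\<bar>) ` base) = \<bar>p i0\<bar>"
    using Max_in [of "(\<lambda>i. \<bar>p i\<bar>) ` base"] by (meson finite_base finite_imageI imageE)
  define n where "n = nat \<bar>p i0\<bar>"
  have n: "int n = \<bar>p i0\<bar>" by (simp add: n_def)
  have le: "\<bar>p i\<bar> \<le> int n" if "i \<in> base" for i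
    unfolding n i0(2) [symmetric] using that by (intro Max_ge) auto
  have "n \<le> m" using R i0(1) n by force
  moreover have "p \<in> box (int n)"
    unfolding box_def
  proof (rule PiE_I)
    fix i assume i: "i \<in> base"
    \<comment> \<open>Any common index of \<open>q\<close> compares the parities of
      \<open>p i\<close> and \<open>p i0\<close>; \<open>i\<close> is at hand.\<close>
    then have "even (int m + p i + q i)" "even (int m + p i0 + q i)" using R i0(1) by auto
    then have "even (int n - p i)" unfolding n by presburger
    then show "p i \<in> {x. \<bar>x\<bar> \<le> int n \<and> even (int n - x)}" using le i by simp
  qed (use R in \<open>auto simp: extensional_def\<close>)
  moreover have "q \<in> box (int m - int n)"
    unfolding box_def
  proof (rule PiE_I)
    fix j assume j: "j \<in> base"
    then have "\<bar>p i0\<bar> + \<bar>q j\<bar> \<le> int m" "even (int m + p i0 + q j)" using R i0(1) by auto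
    then have "\<bar>q j\<bar> \<le> int m - int n" "even (int m - int n - q j)"
      unfolding n by presburger+
    then show "q j \<in> {x. \<bar>x\<bar> \<le> int m - int n \<and> even (int m - int n - x)}" by simp
  qed (use R in \<open>auto simp: extensional_def\<close>)
  ultimately show ?L by (auto simp: params_def)
qed

text \<open>Shifting the row or the column by 2 negates one term alone, so all four sign patterns
  occur among the entries; their nonnegativity bounds the sum of absolute values.\<close>

lemma params_if_encodes:
  assumes "encodes m p q y"
  shows "(restrict p base, restrict q base) \<in> params m"
proof -
  have y: "2 * int (y $ i $ j) = int m + sg j * ext p i + sg i * ext q j" for i j
    using assms by (simp add: encodes_def)
  have "\<bar>p i\<bar> + \<bar>q j\<bar> \<le> int m \<and> even (int m + p i + q j)" if "i \<in> base" "j \<in> base" for i j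
  proof -
    note ext = ext_base [OF that(1)] ext_base [OF that(2)]
    have sgs: "sg (i + 2) = sg i" "sg (j + 2) = sg j"
      using base_translate that by blast+
    let ?a = "sg j * p i" and ?b = "sg i * q j"
    have v: "2 * int (y $ i $ j) = int m + ?a + ?b" "2 * int (y $ (i + 2) $ j) = int m - ?a + ?b"
      "2 * int (y $ i $ (j + 2)) = int m + ?a - ?b" "2 * int (y $ (i + 2) $ (j + 2)) = int m - ?a - ?b"
      using y [of i j] y [of "i + 2" j] y [of i "j + 2"] y [of "i + 2" "j + 2"]
      unfolding ext sgs by simp_all
    then have "even (int m + ?a + ?b)" by (metis dvd_triv_left)
    moreover have "0 \<le> int m + ?a + ?b" "0 \<le> int m - ?a + ?b" "0 \<le> int m + ?a - ?b" "0 \<le> int m - ?a - ?b"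
      unfolding v [symmetric] by simp_all
    ultimately show ?thesis
      using sg_cases [of i] sg_cases [of j] by auto
  qed
  then show ?thesis by (simp add: params_iff)
qed

text \<open>Every value of \<open>ext\<close> is, up to sign, a value on \<open>base\<close>, so
  bound and parity carry over to all 64 cells.\<close>

lemma ex_encodes_if_params:
  assumes "(p, q) \<in> params m"
  shows "\<exists>y. encodes m p q y"
proof -
  let ?v = "\<lambda>i j. int m + sg j * ext p i + sg i * ext q j"
  have "0 \<le> ?v i j \<and> even (?v i j)" for i j
  proof -
    obtain i' j' where ij: "i' \<in> base" "j' \<in> base"
      "ext p i = p i' \<or> ext p i = - p i'" "ext q j = q j' \<or> ext q j = - q j'"
      using ext_cases by metis
    then have "\<bar>p i'\<bar> + \<bar>q j'\<bar> \<le> int m" "even (int m + p i' + q j')"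
      using assms by (auto simp: params_iff)
    then show ?thesis using ij(3,4) sg_cases [of i] sg_cases [of j] by auto
  qed
  then have "encodes m p q (\<chi> i j. nat (?v i j div 2))"
    by (simp add: encodes_def)
  then show ?thesis by blast
qed

lemma encodes_unique:
  assumes "encodes m p q y" "encodes m p q y'"
  shows "y = y'"
proof -
  have "y $ i $ j = y' $ i $ j" for i j
  proof -
    have "2 * int (y $ i $ j) = 2 * int (y' $ i $ j)" using assms by (simp add: encodes_def)
    then show ?thesis by simp
  qed
  then show ?thesis by (simp add: vec_eq_iff)
qed

text \<open>Shows that a square determines its parameters on \<open>base\<close>, which gives
  injectivity of the encoding.\<close>

lemma encodes_parameters:
  assumes "encodes m p q y"
  shows "i \<in> base \<Longrightarrow> p i = int (y $ (i + 2) $ 1) - int (y $ i $ 1)"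
    and "j \<in> base \<Longrightarrow> q j = int (y $ 1 $ (j + 2)) - int (y $ 1 $ j)"
proof -
  have y: "2 * int (y $ i $ j) = int m + sg j * ext p i + sg i * ext q j" for i j
    using assms by (simp add: encodes_def)
  show "p i = int (y $ (i + 2) $ 1) - int (y $ i $ 1)" if "i \<in> base"
    using y [of i 1] y [of "i + 2" 1] base_translate [OF that] unfolding ext_base [OF that] by simp
  show "q j = int (y $ 1 $ (j + 2)) - int (y $ 1 $ j)" if "j \<in> base"
    using y [of 1 j] y [of 1 "j + 2"] base_translate [OF that] unfolding ext_base [OF that] by simp
qed

lemma PF8_eq_card_params: "PF8 (4 * m) = card (params m)"
proof -
  define f where "f = (\<lambda>(p, q). THE y. encodes m p q y)"
  have f: "encodes m p q (f (p, q))" if "(p, q) \<in> params m" for p q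
    unfolding f_def prod.case using ex_encodes_if_params [OF that] encodes_unique by (metis theI)
  have "inj_on f (params m)"
  proof (rule inj_onI, clarify)
    fix p q p' q' assume pq: "(p, q) \<in> params m" "(p', q') \<in> params m" "f (p, q) = f (p', q')"
    have e: "encodes m p q (f (p, q))" "encodes m p' q' (f (p, q))"
      using f [OF pq(1)] f [OF pq(2)] pq(3) by simp_all
    have "p i = p' i" "q i = q' i" if "i \<in> base" for i
      using encodes_parameters [OF e(1)] encodes_parameters [OF e(2)] that by simp_all
    then show "p = p' \<and> q = q'"
      using pq by (metis extensionalityI params_iff)
  qed
  moreover have "f ` params m = {y. pandiagonal_franklin_square (4 * m) y}"
  proof (intro equalityI subsetI)
    fix y assume "y \<in> f ` params m"
    then show "y \<in> {y. pandiagonal_franklin_square (4 * m) y}"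
      using f pandiagonal_franklin_if_encodes by fastforce
  next
    fix y assume "y \<in> {y. pandiagonal_franklin_square (4 * m) y}"
    then obtain p q where e: "encodes m p q y"
      using encodes_if_pandiagonal_franklin [of "4 * m" y] by auto
    \<comment> \<open>\<open>encodes\<close> sees only the values on \<open>base\<close>, whereas
      \<open>params\<close> consists of extensional vectors.\<close>
    let ?pq = "(restrict p base, restrict q base)"
    have pq: "?pq \<in> params m" using params_if_encodes [OF e] .
    have "encodes m (restrict p base) (restrict q base) y" using e by (simp add: encodes_def)
    then have "y = f ?pq" using f [OF pq] encodes_unique by blast
    then show "y \<in> f ` params m" using pq by blast
  qed
  ultimately show ?thesis
    unfolding PF8_def by (metis card_image)
qed

section \<open>Cardinalities of boxes and shells\<close>

text \<open>The values are \<open>n, n - 2, ..., - n\<close>; for negative \<open>n\<close> both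
  sides are 0.\<close>

lemma card_interval_same_parity: "card {x::int. \<bar>x\<bar> \<le> n \<and> even (n - x)} = nat (n + 1)"
proof -
  have "{x::int. \<bar>x\<bar> \<le> n \<and> even (n - x)} = (\<lambda>k. n - 2 * k) ` {0..n}"
  proof (intro equalityI subsetI)
    fix x assume "x \<in> {x. \<bar>x\<bar> \<le> n \<and> even (n - x)}"
    then have x: "\<bar>x\<bar> \<le> n" "even (n - x)" by auto
    then obtain k where "n - x = 2 * k" by blast
    then show "x \<in> (\<lambda>k. n - 2 * k) ` {0..n}" using x by (intro image_eqI [of _ _ k]) auto
  qed auto
  moreover have "inj_on (\<lambda>k. n - 2 * k) {0..n}" by (simp add: inj_on_def)
  ultimately show ?thesis by (simp add: card_image)
qed

lemma card_box: "card (box n) = nat (n + 1) ^ 4"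
  unfolding box_def by (simp only: card_PiE finite_base card_interval_same_parity prod_constant card_base)

lemma finite_box: "finite (box n)"
proof -
  have "finite {x::int. \<bar>x\<bar> \<le> n \<and> even (n - x)}"
    by (rule finite_subset [of _ "{-n..n}"]) auto
  then show ?thesis unfolding box_def by (intro finite_PiE) simp_all
qed

lemma box_mono: "k \<le> n \<Longrightarrow> even (n - k) \<Longrightarrow> box k \<subseteq> box n"
  unfolding box_def by (intro PiE_mono) auto

lemma box_same_parity: "p \<in> box k \<Longrightarrow> p \<in> box n \<Longrightarrow> even (n - k)"
proof -
  assume p: "p \<in> box k" "p \<in> box n"
  have "1 \<in> base" by (simp add: base_def)
  then have "even (k - p 1)" "even (n - p 1)" using p unfolding box_def by fastforce+
  then show "even (n - k)" by presburger
qed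

lemma box_negative: "n < 0 \<Longrightarrow> box n = {}"
  using card_box [of n] finite_box by auto

text \<open>For \<open>n \<ge> 0\<close>, the vectors of \<open>box n\<close> whose maximal absolute
  value is exactly \<open>n\<close>: parity rules out \<open>n - 1\<close>.\<close>

definition shell :: "int \<Rightarrow> (8 \<Rightarrow> int) set" where
  "shell n = box n - box (n - 2)"

text \<open>Replacing \<open>n\<close> by the least admissible \<open>k\<close> keeps the parity and
  only enlarges the box for \<open>q\<close>; it makes the union disjoint.\<close>

lemma params_shells: "params m = (\<Union>n\<le>m. shell (int n) \<times> box (int m - int n))"
proof (intro equalityI subsetI)
  fix z assume "z \<in> params m"
  then obtain p q n where z: "z = (p, q)" and n: "n \<le> m" "p \<in> box (int n)" "q \<in> box (int m - int n)"
    by (auto simp: params_def)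
  define k where "k = (LEAST k. p \<in> box (int k))"
  have k: "p \<in> box (int k)" unfolding k_def using n(2) by (rule LeastI)
  have "k \<le> n" unfolding k_def using n(2) by (rule Least_le)
  have "p \<notin> box (int k - 2)"
  \<comment> \<open>Below 2 the inner box has a negative bound and is empty; otherwise minimality of
    \<open>k\<close> applies to the natural number \<open>k - 2\<close>.\<close>
  proof (cases "k < 2")
    case True
    then show ?thesis by (simp add: box_negative)
  next
    case False
    then have "p \<notin> box (int (k - 2))"
      unfolding k_def by (intro not_less_Least) (simp add: k_def [symmetric])
    then show ?thesis using False by (simp add: of_nat_diff)
  qed
  moreover have "q \<in> box (int m - int k)"
    using n(3) box_mono [of "int m - int n" "int m - int k"] box_same_parity [OF k n(2)] \<open>k \<le> n\<close>
    by auto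
  ultimately show "z \<in> (\<Union>n\<le>m. shell (int n) \<times> box (int m - int n))"
    using z k \<open>k \<le> n\<close> n(1) by (auto simp: shell_def intro!: bexI [of _ k])
qed (auto simp: params_def shell_def)

text \<open>A common vector would force equal parity, hence \<open>k \<le> n - 2\<close>, and so lie
  in the inner box removed from \<open>shell n\<close>.\<close>

lemma disjoint_shells:
  assumes "k < n"
  shows "shell (int k) \<inter> shell (int n) = {}"
proof -
  have False if p: "p \<in> shell (int k)" "p \<in> shell (int n)" for p
  proof -
    have "even (int n - int k)" using p by (intro box_same_parity [of p]) (auto simp: shell_def)
    then have "int k \<le> int n - 2" "even (int n - 2 - int k)" using assms by presburger+
    then have "p \<in> box (int n - 2)" using p(1) box_mono [of "int k" "int n - 2"] by (auto simp: shell_def)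
    then show False using p(2) by (simp add: shell_def)
  qed
  then show ?thesis by blast
qed

text \<open>For positive \<open>n\<close> this is \<open>(n + 1)^4 - (n - 1)^4\<close>. At 0 the
  inner box is empty and does not have \<open>(-1)^4\<close> elements, hence the separate
  value.\<close>

lemma card_shell:
  "card (shell 0) = 1" "real (card (shell (int (Suc k)))) = 8 * real (Suc k) ^ 3 + 8 * real (Suc k)"
proof -
  have "card (shell n) = card (box n) - card (box (n - 2))" for n
    unfolding shell_def using box_mono [of "n - 2" n] by (intro card_Diff_subset finite_box) auto
  moreover have "int k + 2 = int (k + 2)" by simp
  then have "card (box (int (Suc k))) = (k + 2) ^ 4" "card (box (int (Suc k) - 2)) = k ^ 4"
    unfolding card_box by (simp_all add: nat_add_distrib)
  moreover have "k ^ 4 \<le> (k + 2) ^ 4" by (intro power_mono) auto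
  ultimately show "card (shell 0) = 1"
    "real (card (shell (int (Suc k)))) = 8 * real (Suc k) ^ 3 + 8 * real (Suc k)"
    by (simp_all add: card_box of_nat_diff field_simps power_numeral_reduce)
qed

section \<open>Summation over shells and the closed form\<close>

lemma card_params:
  "real (card (params m)) =
     real (m + 1) ^ 4 + (\<Sum>n<m. (8 * real (Suc n) ^ 3 + 8 * real (Suc n)) * (real (m + 1) - real (Suc n)) ^ 4)"
proof -
  have "card (params m) = (\<Sum>n\<le>m. card (shell (int n) \<times> box (int m - int n)))"
    unfolding params_shells
  proof (rule card_UN_disjoint)
    show "\<forall>n\<in>{..m}. finite (shell (int n) \<times> box (int m - int n))"
      by (simp add: shell_def finite_box)
    show "\<forall>k\<in>{..m}. \<forall>n\<in>{..m}. k \<noteq> n \<longrightarrow>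
      (shell (int k) \<times> box (int m - int k)) \<inter> (shell (int n) \<times> box (int m - int n)) = {}"
      using disjoint_shells by (metis Int_commute Times_Int_Times Sigma_empty1 nat_neq_iff)
  qed simp
  also have "real \<dots> = (\<Sum>n\<le>m. real (card (shell (int n))) * (real (m + 1) - real n) ^ 4)"
    unfolding of_nat_sum
  proof (rule sum.cong [OF refl])
    fix n assume n: "n \<in> {..m}"
    then have "nat (int m - int n + 1) = m + 1 - n" by auto
    then have "card (box (int m - int n)) = (m + 1 - n) ^ 4" unfolding card_box by simp
    then show "real (card (shell (int n) \<times> box (int m - int n)))
      = real (card (shell (int n))) * (real (m + 1) - real n) ^ 4"
      using n by (simp add: card_cartesian_product of_nat_diff)
  qed
  also have "\<dots> = real (m + 1) ^ 4 + (\<Sum>n<m. real (card (shell (int (Suc n)))) * (real (m + 1) - real (Suc n)) ^ 4)"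
    by (simp add: sum.atMost_shift card_shell(1))
  finally show ?thesis by (simp only: card_shell(2))
qed

text \<open>
  The coefficients are those of \<open>840 (S\<^sub>3 + S\<^sub>1), \<dots>, 840 (S\<^sub>7 + S\<^sub>5)\<close>, where \<open>S\<^sub>k = 1\<^sup>k + \<dots> + N\<^sup>k\<close>, and come
  from expanding \<open>(c - n)\<^sup>4\<close>.
\<close>

lemma sum_shells:
  fixes c :: real
  defines "S \<equiv> \<lambda>N. c ^ 4 * (210 * N ^ 4 + 420 * N ^ 3 + 630 * N ^ 2 + 420 * N)
      - 4 * c ^ 3 * (168 * N ^ 5 + 420 * N ^ 4 + 560 * N ^ 3 + 420 * N ^ 2 + 112 * N)
      + 6 * c ^ 2 * (140 * N ^ 6 + 420 * N ^ 5 + 560 * N ^ 4 + 420 * N ^ 3 + 140 * N ^ 2)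
      - 4 * c * (120 * N ^ 7 + 420 * N ^ 6 + 588 * N ^ 5 + 420 * N ^ 4 + 140 * N ^ 3 - 8 * N)
      + (105 * N ^ 8 + 420 * N ^ 7 + 630 * N ^ 6 + 420 * N ^ 5 + 105 * N ^ 4)"
  shows "105 * (\<Sum>n<N. (8 * real (Suc n) ^ 3 + 8 * real (Suc n)) * (c - real (Suc n)) ^ 4) = S (real N)"
proof (induction N)
  case 0
  then show ?case by (simp add: S_def)
next
  case (Suc N)
  \<comment> \<open>Telescoping: the summand is the forward difference of \<open>S\<close>, a
    polynomial identity in \<open>x\<close> and \<open>c\<close>.\<close>
  have "105 * ((8 * (x + 1) ^ 3 + 8 * (x + 1)) * (c - (x + 1)) ^ 4) = S (x + 1) - S x" for x
    unfolding S_def by algebra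
  from this [of "real N"] show ?case
    using Suc by (simp add: algebra_simps)
qed

theorem theorem1p4p4:
  fixes s :: nat
  shows "real (PF8 s) =
    (if s mod 4 = 0 then
       1 / 2293760 * real s ^ 8 + 1 / 71680 * real s ^ 7 + 1 / 3840 * real s ^ 6
       + 1 / 320 * real s ^ 5 + 1 / 40 * real s ^ 4 + 2 / 15 * real s ^ 3
       + 197 / 420 * real s ^ 2 + 106 / 105 * real s + 1
     else 0)"
proof (cases "s mod 4 = 0")
  case True
  then obtain m where s: "s = 4 * m" by fastforce
  have "real s = 4 * real m" "real (m + 1) = real m + 1" by (simp_all add: s)
  \<comment> \<open>The factor 105 prepares for \<open>sum_shells\<close> with
    \<open>c = m + 1\<close> and \<open>N = m\<close>.\<close>
  moreover have "105 * real (PF8 s) = 105 * real (m + 1) ^ 4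
      + 105 * (\<Sum>n<m. (8 * real (Suc n) ^ 3 + 8 * real (Suc n)) * (real (m + 1) - real (Suc n)) ^ 4)"
    unfolding s PF8_eq_card_params card_params by (rule distrib_left)
  ultimately have "real (PF8 s) =
       1 / 2293760 * real s ^ 8 + 1 / 71680 * real s ^ 7 + 1 / 3840 * real s ^ 6
       + 1 / 320 * real s ^ 5 + 1 / 40 * real s ^ 4 + 2 / 15 * real s ^ 3
       + 197 / 420 * real s ^ 2 + 106 / 105 * real s + 1"
    unfolding sum_shells by algebra
  with True show ?thesis by simp
next
  case False
  then have "\<not> pandiagonal_franklin_square s y" for y
    using encodes_if_pandiagonal_franklin by fastforce
  with False show ?thesis by (simp add: PF8_def)
qed

end
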